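(* Let $a>0$, $0<\lambda<1$, $\mu=\sqrt{1-\lambda^2}$, let $\alpha(t)=(\cos t,\sin t,\lambda t)$, $t\in\mathbb{R}$ (a spacelike helix of $\mathbb{L}^3$ with timelike axis), and let $V(t)=\sinh(at)\,\mathbf{n}(t)+\cosh(at)\,\mathbf{b}(t)$, where $$\mathbf{n}(t)=(-\cos t,-\sin t,0),\qquad \mathbf{b}(t)=\frac1\mu(\lambda\sin t,-\lambda\cos t,-1).$$ Then the Björling surface with data $\alpha$ and $V$ is parametrized by $X(u,v)=(X_1,X_2,X_3)$, where $$X_1=\frac{\cosh v\big((a^2+1)\cos u-(\mu-a\lambda)\sin u\sinh(au)\sin(av)-(a\mu+\lambda)\cos u\cosh(au)\sin(av)\big)}{a^2+1}+\frac{\sinh v\cos(av)\big((a\mu+\lambda)\sin u\sinh(au)-(\mu-a\lambda)\cos u\cosh(au)\big)}{a^2+1},$$ $$X_2=\frac{\cosh v\big((a^2+1)\sin u-(a\mu+\lambda)\sin u\cosh(au)\sin(av)+(\mu-a\lambda)\cos u\sinh(au)\sin(av)\big)}{a^2+1}-\frac{\sinh v\cos(av)\big((a\mu+\lambda)\cos u\sinh(au)+(\mu-a\lambda)\sin u\cosh(au)\big)}{a^2+1},$$ $$X_3=\lambda u-\frac{\sinh(au)\sin(av)}{a}.$$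
   Context: $\mathbb{L}^3$ is $\mathbb{R}^3$ with the metric $\langle,\rangle=dx^2+dy^2-dz^2$. The Lorentzian cross product is $(x_1,x_2,x_3)\times(y_1,y_2,y_3)=(x_2y_3-x_3y_2,\ x_3y_1-x_1y_3,\ -(x_1y_2-x_2y_1))$, extended complex-bilinearly. A maximal surface is a spacelike surface (induced metric Riemannian) with zero mean curvature everywhere. Björling problem: given a real analytic spacelike curve $\alpha:I\to\mathbb{L}^3$ and a real analytic unit timelike vector field $V$ along $\alpha$ with $\langle V,\alpha'\rangle=0$, find a maximal surface containing $\alpha$ with unit normal $V$ along $\alpha$. Its solution (the Björling surface with data $\alpha,V$, unique with $\alpha$ being the parameter curve $v=0$) is $$X(u,v)=\mathrm{Re}\left(\alpha(z)+i\int_{u_0}^z V(w)\times\alpha'(w)\,dw\right),\qquad z=u+iv,$$ where $u_0\in I$ is fixed and $\alpha(z),V(z)$ are the holomorphic extensions of $\alpha,V$ to a simply-connected domain of $\mathbb{C}$ containing $I\times\{0\}$. Maximality is understood away from points where $X$ fails to be an immersion with nondegenerate induced metric. *)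

theory Defs
  imports "HOL-Complex_Analysis.Complex_Analysis"
begin

section \<open>Lorentz-Minkowski space\<close>

text \<open>Both operations are written over an arbitrary commutative ring, so that the instance at
  complex vectors is the complex-bilinear extension of the instance at real vectors.\<close>

definition lorentz :: "'a::comm_ring_1 ^ 3 \<Rightarrow> 'a ^ 3 \<Rightarrow> 'a" where
  "lorentz x y = x$1 * y$1 + x$2 * y$2 - x$3 * y$3"

definition lcross :: "'a::comm_ring_1 ^ 3 \<Rightarrow> 'a ^ 3 \<Rightarrow> 'a ^ 3" where
  "lcross x y = vector [x$2 * y$3 - x$3 * y$2, x$3 * y$1 - x$1 * y$3, - (x$1 * y$2 - x$2 * y$1)]"

section \<open>Parametrized surfaces\<close>

definition du :: "(real \<Rightarrow> real \<Rightarrow> real ^ 3) \<Rightarrow> real \<Rightarrow> real \<Rightarrow> real ^ 3" where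
  "du X u v = vector_derivative (\<lambda>s. X s v) (at u)"

definition dv :: "(real \<Rightarrow> real \<Rightarrow> real ^ 3) \<Rightarrow> real \<Rightarrow> real \<Rightarrow> real ^ 3" where
  "dv X u v = vector_derivative (\<lambda>s. X u s) (at v)"

definition C1_param :: "(real \<times> real) set \<Rightarrow> (real \<Rightarrow> real \<Rightarrow> real ^ 3) \<Rightarrow> bool" where
  "C1_param U X \<longleftrightarrow>
     (\<forall>(u, v)\<in>U. (\<lambda>s. X s v) differentiable at u \<and> (\<lambda>s. X u s) differentiable at v) \<and>
     continuous_on U (\<lambda>(u, v). du X u v) \<and> continuous_on U (\<lambda>(u, v). dv X u v)"

definition C2_param :: "(real \<times> real) set \<Rightarrow> (real \<Rightarrow> real \<Rightarrow> real ^ 3) \<Rightarrow> bool" where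
  "C2_param U X \<longleftrightarrow> C1_param U X \<and> C1_param U (du X) \<and> C1_param U (dv X)"

definition fff_E :: "(real \<Rightarrow> real \<Rightarrow> real ^ 3) \<Rightarrow> real \<Rightarrow> real \<Rightarrow> real" where
  "fff_E X u v = lorentz (du X u v) (du X u v)"

definition fff_F :: "(real \<Rightarrow> real \<Rightarrow> real ^ 3) \<Rightarrow> real \<Rightarrow> real \<Rightarrow> real" where
  "fff_F X u v = lorentz (du X u v) (dv X u v)"

definition fff_G :: "(real \<Rightarrow> real \<Rightarrow> real ^ 3) \<Rightarrow> real \<Rightarrow> real \<Rightarrow> real" where
  "fff_G X u v = lorentz (dv X u v) (dv X u v)"

definition fff_det :: "(real \<Rightarrow> real \<Rightarrow> real ^ 3) \<Rightarrow> real \<Rightarrow> real \<Rightarrow> real" where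
  "fff_det X u v = fff_E X u v * fff_G X u v - (fff_F X u v)\<^sup>2"

definition spacelike_at :: "(real \<Rightarrow> real \<Rightarrow> real ^ 3) \<Rightarrow> real \<Rightarrow> real \<Rightarrow> bool" where
  "spacelike_at X u v \<longleftrightarrow> fff_E X u v > 0 \<and> fff_det X u v > 0"

text \<open>At a spacelike point the Lorentzian cross product of the two partial derivatives is timelike,
  of square minus the determinant of the first fundamental form.\<close>

definition unit_normal :: "(real \<Rightarrow> real \<Rightarrow> real ^ 3) \<Rightarrow> real \<Rightarrow> real \<Rightarrow> real ^ 3" where
  "unit_normal X u v = (let N = lcross (du X u v) (dv X u v) in (1 / sqrt (- lorentz N N)) *\<^sub>R N)"

text \<open>Only meaningful at spacelike points.  The overall sign of the mean curvature depends on
  conventions; only its vanishing is used.\<close>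

definition mean_curvature :: "(real \<Rightarrow> real \<Rightarrow> real ^ 3) \<Rightarrow> real \<Rightarrow> real \<Rightarrow> real" where
  "mean_curvature X u v =
     (let N = unit_normal X u v;
          e = lorentz (du (du X) u v) N;
          f = lorentz (dv (du X) u v) N;
          g = lorentz (dv (dv X) u v) N
      in (e * fff_G X u v - 2 * f * fff_F X u v + g * fff_E X u v) / (2 * fff_det X u v))"

text \<open>Points where the first fundamental form is degenerate (in particular all points where
  \<open>X\<close> is not an immersion) are exempt.\<close>

definition maximal_surface :: "(real \<times> real) set \<Rightarrow> (real \<Rightarrow> real \<Rightarrow> real ^ 3) \<Rightarrow> bool" where
  "maximal_surface U X \<longleftrightarrow> open U \<and> C2_param U X \<and>
     (\<forall>(u, v)\<in>U. fff_det X u v \<noteq> 0 \<longrightarrow> spacelike_at X u v \<and> mean_curvature X u v = 0)"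

section \<open>The Bjoerling problem\<close>

definition real_analytic_curve :: "real set \<Rightarrow> (real \<Rightarrow> real ^ 3) \<Rightarrow> bool" where
  "real_analytic_curve I f \<longleftrightarrow>
     (\<forall>t\<^sub>0\<in>I. \<exists>r>0. \<exists>c. \<forall>t. \<bar>t - t\<^sub>0\<bar> < r \<longrightarrow> (\<lambda>n. (t - t\<^sub>0) ^ n *\<^sub>R c n) sums f t)"

definition bjorling_data :: "real set \<Rightarrow> (real \<Rightarrow> real ^ 3) \<Rightarrow> (real \<Rightarrow> real ^ 3) \<Rightarrow> bool" where
  "bjorling_data I \<alpha> V \<longleftrightarrow>
     open I \<and> is_interval I \<and> I \<noteq> {} \<and>
     real_analytic_curve I \<alpha> \<and> real_analytic_curve I V \<and>
     (\<forall>t\<in>I. lorentz (vector_derivative \<alpha> (at t)) (vector_derivative \<alpha> (at t)) > 0 \<and>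
            lorentz (V t) (V t) = -1 \<and>
            lorentz (V t) (vector_derivative \<alpha> (at t)) = 0)"

text \<open>The curve is the parameter curve \<open>v = 0\<close>, and \<open>V\<close>, which is unit timelike, is normal to
  the surface along it.\<close>

definition solves_bjorling_problem ::
  "real set \<Rightarrow> (real \<Rightarrow> real ^ 3) \<Rightarrow> (real \<Rightarrow> real ^ 3) \<Rightarrow> (real \<times> real) set \<Rightarrow>
   (real \<Rightarrow> real \<Rightarrow> real ^ 3) \<Rightarrow> bool" where
  "solves_bjorling_problem I \<alpha> V U X \<longleftrightarrow>
     maximal_surface U X \<and> I \<times> {0} \<subseteq> U \<and>
     (\<forall>t\<in>I. X t 0 = \<alpha> t \<and> spacelike_at X t 0 \<and> lorentz (V t) (V t) = -1 \<and>
            lorentz (V t) (du X t 0) = 0 \<and> lorentz (V t) (dv X t 0) = 0)"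

definition holomorphic_extension ::
  "real set \<Rightarrow> (real \<Rightarrow> real ^ 3) \<Rightarrow> complex set \<Rightarrow> (complex \<Rightarrow> complex ^ 3) \<Rightarrow> bool" where
  "holomorphic_extension I f \<Omega> F \<longleftrightarrow>
     (\<forall>i. (\<lambda>z. F z $ i) holomorphic_on \<Omega>) \<and>
     (\<forall>t\<in>I. \<forall>i. F (complex_of_real t) $ i = complex_of_real (f t $ i))"

definition cderiv :: "(complex \<Rightarrow> complex ^ 3) \<Rightarrow> complex \<Rightarrow> complex ^ 3" where
  "cderiv F z = (\<chi> i. deriv (\<lambda>w. F w $ i) z)"

text \<open>The integral from \<open>u\<^sub>0\<close> to \<open>z\<close> is taken along an arbitrary path inside the
  simply connected domain \<open>\<Omega>\<close>.\<close>

definition bjorling_surface ::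
  "real set \<Rightarrow> (real \<Rightarrow> real ^ 3) \<Rightarrow> (real \<Rightarrow> real ^ 3) \<Rightarrow> complex set \<Rightarrow> real \<Rightarrow>
   (real \<Rightarrow> real \<Rightarrow> real ^ 3) \<Rightarrow> bool" where
  "bjorling_surface I \<alpha> V \<Omega> u\<^sub>0 X \<longleftrightarrow>
     open \<Omega> \<and> simply_connected \<Omega> \<and> complex_of_real ` I \<subseteq> \<Omega> \<and> u\<^sub>0 \<in> I \<and>
     (\<exists>A W. holomorphic_extension I \<alpha> \<Omega> A \<and> holomorphic_extension I V \<Omega> W \<and>
        (\<forall>z\<in>\<Omega>. \<forall>\<gamma>. valid_path \<gamma> \<and> path_image \<gamma> \<subseteq> \<Omega> \<and>
            pathstart \<gamma> = complex_of_real u\<^sub>0 \<and> pathfinish \<gamma> = z \<longrightarrow>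
          X (Re z) (Im z) =
            (\<chi> i. Re (A z $ i + \<i> * contour_integral \<gamma> (\<lambda>w. lcross (W w) (cderiv A w) $ i)))))"

end

theory Submission
  imports Defs
begin

text \<open>Let \<open>A\<close>, \<open>W\<close> be the entire extensions of \<open>\<alpha>\<close>, \<open>V\<close>, and let \<open>P\<close> be an entire primitive
  of \<open>W \<times> A'\<close> that is real on the real axis, so that the Bjoerling formula reads
  \<open>X = Re (A + \<i> P)\<close>.  Since \<open>\<langle>W, W\<rangle> = -1\<close> and \<open>\<langle>W, A'\<rangle> = 0\<close>, Lagrange's identity gives
  \<open>\<langle>P', P'\<rangle> = \<langle>A', A'\<rangle>\<close>, and \<open>\<langle>A', P'\<rangle> = 0\<close>, so \<open>A + \<i> P\<close> is an isotropic curve.  Its real part is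
  therefore harmonic and conformal, hence maximal wherever it is nondegenerate.  For the helix,
  \<open>W \<times> A'\<close> is a combination of products of \<open>sin z\<close>, \<open>cos z\<close> with \<open>sinh (a z)\<close>, \<open>cosh (a z)\<close>, and
  its primitive has the same shape.\<close>

no_notation fps_nth (infixl "$" 75)

section \<open>Real parts of entire curves and their partial derivatives\<close>

definition entire_curve :: "(complex \<Rightarrow> complex ^ 'n) \<Rightarrow> bool" where
  "entire_curve F \<longleftrightarrow> (\<forall>i. (\<lambda>z. F z $ i) holomorphic_on UNIV)"

definition re_param :: "(complex \<Rightarrow> complex ^ 'n) \<Rightarrow> real \<Rightarrow> real \<Rightarrow> real ^ 'n" where
  "re_param F u v = (\<chi> i. Re (F (Complex u v) $ i))"

lemma re_param_nth [simp]: "re_param F u v $ i = Re (F (Complex u v) $ i)"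
  by (simp add: re_param_def)

lemma cderiv_nth [simp]: "cderiv F z $ i = deriv (\<lambda>w. F w $ i) z"
  by (simp add: cderiv_def)

lemma entire_curve_DERIV:
  assumes "entire_curve F"
  shows "((\<lambda>z. F z $ i) has_field_derivative cderiv F z $ i) (at z)"
  using assms holomorphic_derivI[of _ UNIV z] by (simp add: entire_curve_def)

lemma entire_curve_cderiv: "entire_curve F \<Longrightarrow> entire_curve (cderiv F)"
  by (simp add: entire_curve_def holomorphic_deriv)

lemma entire_curve_smult: "entire_curve F \<Longrightarrow> entire_curve (\<lambda>z. c *s F z)"
  by (auto simp: entire_curve_def intro!: holomorphic_intros)

lemma cderiv_eqI:
  assumes "\<And>i. ((\<lambda>w. F w $ i) has_field_derivative D $ i) (at z)"
  shows "cderiv F z = D"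
  using assms by (simp add: vec_eq_iff DERIV_imp_deriv)

lemma cderiv_smult:
  assumes "entire_curve F"
  shows "cderiv (\<lambda>z. c *s F z) z = c *s cderiv F z"
proof (rule cderiv_eqI)
  fix i show "((\<lambda>w. (c *s F w) $ i) has_field_derivative (c *s cderiv F z) $ i) (at z)"
    using DERIV_cmult[OF entire_curve_DERIV[OF assms, of i z], of c] by simp
qed

lemma has_vector_derivative_vecI:
  fixes f :: "real \<Rightarrow> real ^ 'n"
  assumes "\<And>i. ((\<lambda>t. f t $ i) has_real_derivative D $ i) (at t)"
  shows "(f has_vector_derivative D) (at t)"
  unfolding has_vector_derivative_def
proof (subst has_derivative_componentwise_within, intro ballI)
  fix b :: "real ^ 'n" assume "b \<in> Basis"
  then obtain i where "b = axis i 1" by (auto simp: Basis_vec_def)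
  then show "((\<lambda>s. f s \<bullet> b) has_derivative (\<lambda>s. (s *\<^sub>R D) \<bullet> b)) (at t)"
    using assms[of i] by (simp add: inner_axis has_field_derivative_def mult_commute_abs)
qed

lemma re_param_has_derivative_u:
  assumes "entire_curve F"
  shows "((\<lambda>s. re_param F s v) has_vector_derivative re_param (cderiv F) u v) (at u)"
proof (rule has_vector_derivative_vecI)
  fix i
  have "((\<lambda>s. Complex s v) has_vector_derivative 1) (at u)"
    unfolding Complex_eq by (auto intro!: derivative_eq_intros)
  from field_vector_diff_chain_at[OF this entire_curve_DERIV[OF assms, of i]]
  have "((\<lambda>s. F (Complex s v) $ i) has_vector_derivative cderiv F (Complex u v) $ i) (at u)"
    by (simp add: o_def)
  from bounded_linear.has_vector_derivative[OF bounded_linear_Re this]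
  show "((\<lambda>s. re_param F s v $ i) has_real_derivative re_param (cderiv F) u v $ i) (at u)"
    by (simp add: has_real_derivative_iff_has_vector_derivative)
qed

text \<open>The vertical line \<open>s \<mapsto> Complex u s\<close> has velocity
  \<open>\<i>\<close>, so the chain rule produces the factor \<open>\<i>\<close>. Together with the
  \<open>u\<close>-derivative this shows that partial differentiation stays within real parts of
  entire curves, so that partial derivatives of any order reduce to complex ones.\<close>

lemma re_param_has_derivative_v:
  assumes "entire_curve F"
  shows "((\<lambda>s. re_param F u s) has_vector_derivative re_param (\<lambda>z. \<i> *s cderiv F z) u v) (at v)"
proof (rule has_vector_derivative_vecI)
  fix i
  have "((\<lambda>s. Complex u s) has_vector_derivative \<i>) (at v)"
    unfolding Complex_eq by (auto intro!: derivative_eq_intros)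
  from field_vector_diff_chain_at[OF this entire_curve_DERIV[OF assms, of i]]
  have "((\<lambda>s. F (Complex u s) $ i) has_vector_derivative \<i> * cderiv F (Complex u v) $ i) (at v)"
    by (simp add: o_def)
  from bounded_linear.has_vector_derivative[OF bounded_linear_Re this]
  show "((\<lambda>s. re_param F u s $ i) has_real_derivative
      re_param (\<lambda>z. \<i> *s cderiv F z) u v $ i) (at v)"
    by (simp add: has_real_derivative_iff_has_vector_derivative)
qed

lemma du_re_param:
  fixes F :: "complex \<Rightarrow> complex ^ 3"
  shows "entire_curve F \<Longrightarrow> du (re_param F) = re_param (cderiv F)"
  by (intro ext) (simp add: du_def vector_derivative_at[OF re_param_has_derivative_u])

lemma dv_re_param:
  fixes F :: "complex \<Rightarrow> complex ^ 3"
  shows "entire_curve F \<Longrightarrow> dv (re_param F) = re_param (\<lambda>z. \<i> *s cderiv F z)"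
  by (intro ext) (simp add: dv_def vector_derivative_at[OF re_param_has_derivative_v])

lemma continuous_on_re_param:
  assumes "entire_curve F"
  shows "continuous_on S (\<lambda>(u, v). re_param F u v)"
proof -
  have "continuous_on S (\<lambda>p. F (Complex (fst p) (snd p)) $ i)" for i
  proof (rule continuous_on_compose2[of UNIV "\<lambda>z. F z $ i"])
    show "continuous_on UNIV (\<lambda>z. F z $ i)"
      using assms by (simp add: entire_curve_def holomorphic_on_imp_continuous_on)
    show "continuous_on S (\<lambda>p. Complex (fst p) (snd p))"
      unfolding Complex_eq by (intro continuous_intros)
  qed simp
  then show ?thesis
    unfolding re_param_def case_prod_unfold
    by (intro continuous_on_vec_lambda continuous_on_Re)
qed

lemma C1_param_re_param:
  assumes "entire_curve F"
  shows "C1_param U (re_param F)"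
proof -
  have "(\<lambda>s. re_param F s v) differentiable at u" "(\<lambda>s. re_param F u s) differentiable at v" for u v
    using re_param_has_derivative_u[OF assms] re_param_has_derivative_v[OF assms]
    by (blast intro: differentiableI_vector)+
  moreover have "continuous_on U (\<lambda>(u, v). re_param (cderiv F) u v)"
    "continuous_on U (\<lambda>(u, v). re_param (\<lambda>z. \<i> *s cderiv F z) u v)"
    by (intro continuous_on_re_param entire_curve_smult entire_curve_cderiv assms)+
  ultimately show ?thesis
    unfolding C1_param_def du_re_param[OF assms] dv_re_param[OF assms] by blast
qed

text \<open>Both first partials are again of the form \<open>re_param G\<close> with
  \<open>G\<close> entire, so the C1 result applies to the map and to each partial.\<close>

lemma C2_param_re_param: "entire_curve F \<Longrightarrow> C2_param U (re_param F)"
  by (simp add: C2_param_def C1_param_re_param du_re_param dv_re_param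
      entire_curve_cderiv entire_curve_smult)

section \<open>Algebra of the Lorentzian product and cross product\<close>

lemma lorentz_minus [simp]: "lorentz (- x) y = - lorentz x y" "lorentz x (- y) = - lorentz x y"
  by (simp_all add: lorentz_def)

lemma lorentz_lcross_left: "lorentz x (lcross x y) = 0"
  and lorentz_lcross_right: "lorentz y (lcross x y) = 0"
  by (simp_all add: lorentz_def lcross_def algebra_simps)

text \<open>Lagrange's identity, with the sign opposite to the Euclidean one. If \<open>x\<close>
  has square -1 and is orthogonal to \<open>y\<close>, it says that \<open>lcross x y\<close> has
  the same square as \<open>y\<close>.\<close>

lemma lorentz_lcross_lcross:
  "lorentz (lcross x y) (lcross x y) = (lorentz x y)\<^sup>2 - lorentz x x * lorentz y y"
  by (simp add: lorentz_def lcross_def algebra_simps power2_eq_square)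

text \<open>Two timelike vectors are never orthogonal, by the Cauchy--Schwarz inequality in the plane.\<close>

lemma lorentz_nonneg_of_conformal:
  fixes x y :: "real ^ 3"
  assumes "lorentz x x = lorentz y y" "lorentz x y = 0"
  shows "lorentz x x \<ge> 0"
proof (rule ccontr)
  assume neg: "\<not> lorentz x x \<ge> 0"
  let ?p = "(x$1)\<^sup>2 + (x$2)\<^sup>2" and ?q = "(y$1)\<^sup>2 + (y$2)\<^sup>2"
  \<comment> \<open>Equality of the two squares carries the negative sign over to \<open>y\<close>,
    so both vectors are timelike.\<close>
  have p: "?p < (x$3)\<^sup>2" and q: "?q < (y$3)\<^sup>2"
    using neg assms(1) by (simp_all add: lorentz_def power2_eq_square)
  have "(x$3)\<^sup>2 * (y$3)\<^sup>2 = (x$1 * y$1 + x$2 * y$2)\<^sup>2"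
    using assms(2) by (simp add: lorentz_def flip: power_mult_distrib)
  also have "\<dots> = ?p * ?q - (x$1 * y$2 - x$2 * y$1)\<^sup>2"
    by (simp add: power2_eq_square algebra_simps)
  also have "\<dots> \<le> ?p * ?q" by simp
  also have "\<dots> < (x$3)\<^sup>2 * (y$3)\<^sup>2"
    using p q by (intro mult_strict_mono') auto
  finally show False by simp
qed

section \<open>Isotropic curves and maximal surfaces\<close>

context
  fixes F :: "complex \<Rightarrow> complex ^ 3"
  assumes entire: "entire_curve F"
    and isotropic: "\<And>z. lorentz (cderiv F z) (cderiv F z) = 0"
begin

text \<open>Write \<open>F' = p + \<i> q\<close> with \<open>p\<close>, \<open>q\<close> real, so
  that the partials are \<open>p\<close> and \<open>- q\<close>. The real part of the square of
  \<open>F'\<close> is \<open><p,p> - <q,q>\<close> and its imaginary part is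
  \<open>2 <p,q>\<close>; both vanish.\<close>

lemma fff_re_param_isotropic:
  "fff_G (re_param F) u v = fff_E (re_param F) u v"
  "fff_F (re_param F) u v = 0"
proof -
  have "Re (lorentz (cderiv F (Complex u v)) (cderiv F (Complex u v))) = 0"
    "Im (lorentz (cderiv F (Complex u v)) (cderiv F (Complex u v))) = 0"
    by (simp_all only: isotropic complex.sel zero_complex.sel)
  then show "fff_G (re_param F) u v = fff_E (re_param F) u v" "fff_F (re_param F) u v = 0"
    by (simp_all add: fff_E_def fff_F_def fff_G_def du_re_param[OF entire] dv_re_param[OF entire]
        lorentz_def algebra_simps)
qed

lemma fff_det_re_param_isotropic:
  "fff_det (re_param F) u v = (fff_E (re_param F) u v)\<^sup>2"
  by (simp add: fff_det_def fff_re_param_isotropic power2_eq_square)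

lemma fff_E_re_param_isotropic_nonneg: "fff_E (re_param F) u v \<ge> 0"
  using fff_re_param_isotropic[of u v] unfolding fff_E_def fff_F_def fff_G_def
  by (intro lorentz_nonneg_of_conformal[of _ "dv (re_param F) u v"]) simp_all

text \<open>Harmonicity gives \<open>g = - e\<close>, and conformality turns the numerator into
  \<open>(e + g) * E\<close>, which is zero. The numerator itself vanishes, so the identity holds at
  degenerate points as well.\<close>

lemma mean_curvature_re_param_isotropic: "mean_curvature (re_param F) u v = 0"
proof -
  have "dv (dv (re_param F)) u v = - du (du (re_param F)) u v"
    by (simp add: vec_eq_iff du_re_param dv_re_param entire entire_curve_cderiv
        entire_curve_smult cderiv_smult del: cderiv_nth)
  then show ?thesis
    by (simp add: mean_curvature_def Let_def fff_re_param_isotropic)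
qed

text \<open>The determinant is \<open>E\<^sup>2\<close>, so where it is nonzero the inequality
  \<open>E \<ge> 0\<close> becomes strict.\<close>

lemma maximal_surface_re_param_isotropic: "maximal_surface UNIV (re_param F)"
  using fff_E_re_param_isotropic_nonneg
  by (auto simp: maximal_surface_def C2_param_re_param[OF entire] spacelike_at_def
      fff_det_re_param_isotropic mean_curvature_re_param_isotropic order.not_eq_order_implies_strict)

end

section \<open>Restriction of holomorphic curves to the real axis\<close>

lemma real_analytic_curve_of_holomorphic_extension:
  assumes "holomorphic_extension I f \<Omega> F" "open \<Omega>" "open I" "complex_of_real ` I \<subseteq> \<Omega>"
  shows "real_analytic_curve I f"
  unfolding real_analytic_curve_def
proof
  fix t\<^sub>0 assume t0: "t\<^sub>0 \<in> I"
  \<comment> \<open>\<open>r1\<close> keeps the Taylor disc of \<open>F\<close> inside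
    \<open>\<Omega>\<close>; \<open>r2\<close> keeps \<open>t\<close> inside \<open>I\<close>, where
    \<open>F\<close> agrees with \<open>f\<close>.\<close>
  obtain r1 where r1: "r1 > 0" "ball (complex_of_real t\<^sub>0) r1 \<subseteq> \<Omega>"
    using openE[OF assms(2), of "of_real t\<^sub>0"] assms(4) t0 by blast
  obtain r2 where r2: "r2 > 0" "ball t\<^sub>0 r2 \<subseteq> I"
    using openE[OF assms(3) t0] by blast
  \<comment> \<open>Taking real parts commutes with multiplication by the real powers of
    \<open>t - t\<^sub>0\<close>, so the real part of the Taylor series of \<open>F\<close> is a
    power series for \<open>f\<close>.\<close>
  define c where "c n = (\<chi> i. Re ((deriv ^^ n) (\<lambda>z. F z $ i) (of_real t\<^sub>0) / fact n))" for n
  have "(\<lambda>n. (t - t\<^sub>0) ^ n *\<^sub>R c n) sums f t" if t: "\<bar>t - t\<^sub>0\<bar> < min r1 r2" for t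
  proof -
    have tI: "t \<in> I" using t r2 by (auto simp: subset_iff dist_real_def abs_minus_commute)
    have "(\<lambda>n. (t - t\<^sub>0) ^ n * c n $ i) sums (f t $ i)" for i
    proof -
      have "(\<lambda>z. F z $ i) holomorphic_on ball (of_real t\<^sub>0) r1"
        using assms(1) r1 by (auto simp: holomorphic_extension_def intro: holomorphic_on_subset)
      moreover have "complex_of_real t \<in> ball (of_real t\<^sub>0) r1"
        using t by (simp add: dist_of_real dist_real_def abs_minus_commute)
      ultimately have "(\<lambda>n. (deriv ^^ n) (\<lambda>z. F z $ i) (of_real t\<^sub>0) / fact n *
          (of_real t - of_real t\<^sub>0) ^ n) sums F (of_real t) $ i"
        by (rule holomorphic_power_series)
      from sums_Re[OF this] show ?thesis
        using assms(1) tI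
        by (simp add: holomorphic_extension_def c_def mult.commute
            del: times_divide_eq_left times_divide_eq_right flip: of_real_diff of_real_power)
    qed
    then show ?thesis
      by (simp add: sums_def vec_tendstoI)
  qed
  then show "\<exists>r>0. \<exists>c. \<forall>t. \<bar>t - t\<^sub>0\<bar> < r \<longrightarrow> (\<lambda>n. (t - t\<^sub>0) ^ n *\<^sub>R c n) sums f t"
    using r1 r2 by (intro exI[of _ "min r1 r2"]) auto
qed

lemma has_vector_derivative_of_holomorphic_extension:
  assumes "holomorphic_extension UNIV f UNIV F"
  shows "(f has_vector_derivative re_param (cderiv F) t 0) (at t)"
proof -
  have "entire_curve F" "f = (\<lambda>s. re_param F s 0)"
    using assms by (auto simp: holomorphic_extension_def entire_curve_def vec_eq_iff
        simp flip: complex_of_real_def)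
  then show ?thesis using re_param_has_derivative_u by metis
qed

text \<open>The imaginary part of \<open>F\<close> is constantly zero along the real axis, hence so
  is that of its derivative; the real part is the derivative of \<open>f\<close>.\<close>

lemma holomorphic_extension_cderiv:
  assumes "holomorphic_extension UNIV f UNIV F"
  shows "holomorphic_extension UNIV (\<lambda>t. vector_derivative f (at t)) UNIV (cderiv F)"
proof -
  have "cderiv F (of_real t) $ i = of_real (vector_derivative f (at t) $ i)" for t i
  proof -
    have "((\<lambda>w. F w $ i) has_field_derivative cderiv F (of_real t) $ i) (at (of_real t))"
      using assms entire_curve_DERIV by (auto simp: holomorphic_extension_def entire_curve_def)
    from has_vector_derivative_real_field[OF this]
    have "((\<lambda>s. complex_of_real (f s $ i)) has_vector_derivative cderiv F (of_real t) $ i) (at t)"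
      using assms by (simp add: holomorphic_extension_def)
    from bounded_linear.has_vector_derivative[OF bounded_linear_Im this]
    have "((\<lambda>s. 0::real) has_vector_derivative Im (cderiv F (of_real t) $ i)) (at t)" by simp
    then have "Im (cderiv F (of_real t) $ i) = 0"
      using vector_derivative_at vector_derivative_const_at by metis
    moreover have "vector_derivative f (at t) = re_param (cderiv F) t 0"
      by (rule vector_derivative_at[OF has_vector_derivative_of_holomorphic_extension[OF assms]])
    ultimately show ?thesis by (simp add: complex_eq_iff complex_of_real_def)
  qed
  then show ?thesis
    using assms by (auto simp: holomorphic_extension_def intro: holomorphic_deriv)
qed

section \<open>The Bjoerling problem for data with entire extensions\<close>

lemma lorentz_of_real:
  assumes "\<And>i. x $ i = of_real (x' $ i)" "\<And>i. y $ i = of_real (y' $ i)"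
  shows "lorentz x y = of_real (lorentz x' y')"
  by (simp add: lorentz_def assms)

text \<open>Here \<open>P\<close> is an entire primitive of \<open>W \<times> A'\<close> that is real on the real axis, so the
  choice of the base point \<open>u\<^sub>0\<close> does not affect the real part in the representation formula.\<close>

locale entire_bjorling =
  fixes \<alpha> V \<beta> :: "real \<Rightarrow> real ^ 3" and A W P :: "complex \<Rightarrow> complex ^ 3"
  assumes A: "holomorphic_extension UNIV \<alpha> UNIV A"
    and W: "holomorphic_extension UNIV V UNIV W"
    and P: "holomorphic_extension UNIV \<beta> UNIV P"
    and cderiv_P: "\<And>z. cderiv P z = lcross (W z) (cderiv A z)"
    and W_unit: "\<And>z. lorentz (W z) (W z) = -1"
    and W_normal: "\<And>z. lorentz (W z) (cderiv A z) = 0"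
    and spacelike: "\<And>t. lorentz (vector_derivative \<alpha> (at t)) (vector_derivative \<alpha> (at t)) > 0"
begin

lemma entire: "entire_curve A" "entire_curve P"
  using A P by (simp_all add: holomorphic_extension_def entire_curve_def)

abbreviation surface :: "real \<Rightarrow> real \<Rightarrow> real ^ 3" where
  "surface \<equiv> re_param (\<lambda>z. A z + \<i> *s P z)"

lemma entire_surface: "entire_curve (\<lambda>z. A z + \<i> *s P z)"
  using entire by (auto simp: entire_curve_def intro!: holomorphic_intros)

lemma cderiv_surface: "cderiv (\<lambda>z. A z + \<i> *s P z) z = cderiv A z + \<i> *s cderiv P z"
proof (rule cderiv_eqI)
  fix i
  show "((\<lambda>w. (A w + \<i> *s P w) $ i) has_field_derivative (cderiv A z + \<i> *s cderiv P z) $ i) (at z)"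
    using DERIV_add[OF entire_curve_DERIV[OF entire(1), of i z]
        DERIV_cmult[OF entire_curve_DERIV[OF entire(2), of i z], of \<i>]] by simp
qed

lemma isotropic:
  "lorentz (cderiv (\<lambda>z. A z + \<i> *s P z) z) (cderiv (\<lambda>z. A z + \<i> *s P z) z) = 0"
proof -
  have expand: "lorentz (x + \<i> *s y) (x + \<i> *s y) = lorentz x x - lorentz y y + 2 * \<i> * lorentz x y"
    for x y by (simp add: lorentz_def algebra_simps)
  show ?thesis
    by (simp add: cderiv_surface expand cderiv_P lorentz_lcross_right lorentz_lcross_lcross
        W_unit W_normal del: cderiv_nth)
qed

lemma of_real_eqs:
  "W (of_real t) $ i = of_real (V t $ i)"
  "cderiv A (of_real t) $ i = of_real (vector_derivative \<alpha> (at t) $ i)"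
  "cderiv P (of_real t) $ i = of_real (vector_derivative \<beta> (at t) $ i)"
  using W holomorphic_extension_cderiv[OF A] holomorphic_extension_cderiv[OF P]
  by (simp_all add: holomorphic_extension_def)

text \<open>The complex identities are restricted to the real axis. There the derivative of
  \<open>\<beta>\<close> is the cross product of \<open>V\<close> with the derivative of
  \<open>\<alpha>\<close>, hence orthogonal to \<open>V\<close>.\<close>

lemma V_unit: "lorentz (V t) (V t) = -1"
  and V_normal: "lorentz (V t) (vector_derivative \<alpha> (at t)) = 0"
  and V_conormal: "lorentz (V t) (vector_derivative \<beta> (at t)) = 0"
proof -
  have "complex_of_real (lorentz (V t) (V t)) = of_real (-1)"
    using W_unit[of "of_real t"] by (simp add: lorentz_of_real[OF of_real_eqs(1) of_real_eqs(1)])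
  then show "lorentz (V t) (V t) = -1" by (simp only: of_real_eq_iff)
  show "lorentz (V t) (vector_derivative \<alpha> (at t)) = 0"
    using W_normal[of "of_real t"] lorentz_of_real[OF of_real_eqs(1,2)] by simp
  show "lorentz (V t) (vector_derivative \<beta> (at t)) = 0"
    using lorentz_lcross_left[of "W (of_real t)" "cderiv A (of_real t)"]
      lorentz_of_real[OF of_real_eqs(1,3)] cderiv_P by simp
qed

lemma bjorling_data: "bjorling_data UNIV \<alpha> V"
  using A W spacelike V_unit V_normal
  by (auto simp: bjorling_data_def intro: real_analytic_curve_of_holomorphic_extension)

lemma solves_bjorling_problem: "solves_bjorling_problem UNIV \<alpha> V UNIV surface"
proof -
  have "surface t 0 = \<alpha> t" for t
    using A P by (simp add: vec_eq_iff holomorphic_extension_def flip: complex_of_real_def)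
  moreover have du: "du surface t 0 = vector_derivative \<alpha> (at t)" for t
    by (simp add: vec_eq_iff du_re_param entire_surface cderiv_surface of_real_eqs
        flip: complex_of_real_def del: cderiv_nth)
  \<comment> \<open>At real points the derivatives of \<open>A\<close> and \<open>P\<close> are
    real, so the real part of \<open>\<i> * (A' + \<i> * P')\<close> is \<open>- P'\<close>.\<close>
  moreover have "dv surface t 0 = - vector_derivative \<beta> (at t)" for t
    by (simp add: vec_eq_iff dv_re_param entire_surface cderiv_surface of_real_eqs
        flip: complex_of_real_def del: cderiv_nth)
  moreover have "spacelike_at surface t 0" for t
    using spacelike[of t]
    by (simp add: spacelike_at_def fff_det_re_param_isotropic[OF entire_surface isotropic]
        fff_E_def du)
  moreover have "maximal_surface UNIV surface"
    by (rule maximal_surface_re_param_isotropic[OF entire_surface isotropic])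
  ultimately show ?thesis
    using V_unit V_normal V_conormal by (simp add: solves_bjorling_problem_def)
qed

text \<open>The entire primitive \<open>P\<close> turns every contour integral into a difference of
  end-point values, and \<open>A\<close>, \<open>W\<close> restricted to \<open>\<Omega>\<close>
  serve as the holomorphic extensions.\<close>

lemma bjorling_surface:
  assumes "open \<Omega>" "simply_connected \<Omega>" "range complex_of_real \<subseteq> \<Omega>"
  shows "bjorling_surface UNIV \<alpha> V \<Omega> u\<^sub>0 surface"
proof -
  have restrict: "holomorphic_extension UNIV f \<Omega> F" if "holomorphic_extension UNIV f UNIV F" for f F
    using that by (auto simp: holomorphic_extension_def intro: holomorphic_on_subset)
  have "surface (Re z) (Im z) =
      (\<chi> i. Re (A z $ i + \<i> * contour_integral \<gamma> (\<lambda>w. lcross (W w) (cderiv A w) $ i)))"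
    if \<gamma>: "valid_path \<gamma>" "pathstart \<gamma> = complex_of_real u\<^sub>0" "pathfinish \<gamma> = z" for \<gamma> z
  proof -
    have "contour_integral \<gamma> (\<lambda>w. lcross (W w) (cderiv A w) $ i) = P z $ i - P (of_real u\<^sub>0) $ i" for i
      using contour_integral_primitive[of UNIV "\<lambda>z. P z $ i" "\<lambda>w. cderiv P w $ i" \<gamma>]
        entire_curve_DERIV[OF entire(2)] \<gamma>
      by (intro contour_integral_unique) (simp add: cderiv_P del: cderiv_nth)
    moreover have "P (of_real u\<^sub>0) $ i = of_real (\<beta> u\<^sub>0 $ i)" for i
      using P by (simp add: holomorphic_extension_def)
    ultimately show ?thesis by (simp add: vec_eq_iff)
  qed
  then show ?thesis
    unfolding bjorling_surface_def using assms restrict[OF A] restrict[OF W] by blast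
qed

end

section \<open>Real and imaginary parts of the complex trigonometric and hyperbolic
  functions\<close>

lemma sinh_of_real: "sinh (complex_of_real x) = of_real (sinh x)"
  and cosh_of_real: "cosh (complex_of_real x) = of_real (cosh x)"
  by (simp_all add: sinh_field_def cosh_field_def flip: exp_of_real of_real_minus)

lemma sinh_Complex: "sinh (Complex x y) = Complex (sinh x * cos y) (cosh x * sin y)"
  and cosh_Complex: "cosh (Complex x y) = Complex (cosh x * cos y) (sinh x * sin y)"
  by (simp_all add: sinh_field_def cosh_field_def complex_eq_iff Re_exp Im_exp field_simps)

lemma sin_Complex: "sin (Complex x y) = Complex (sin x * cosh y) (cos x * sinh y)"
  and cos_Complex: "cos (Complex x y) = Complex (cos x * cosh y) (- (sin x * sinh y))"
  by (simp_all add: sinh_field_def cosh_field_def complex_eq_iff Re_sin Im_sin Re_cos Im_cos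
      field_simps)

section \<open>The helix and its explicit surface\<close>

theorem mainTheorem3:
  fixes a l \<mu> :: real
    and \<alpha> n b V :: "real \<Rightarrow> real ^ 3"
    and X :: "real \<Rightarrow> real \<Rightarrow> real ^ 3"
  assumes "a > 0" and "0 < l" and "l < 1" and "\<mu> = sqrt (1 - l\<^sup>2)"
    and "\<And>t. \<alpha> t = vector [cos t, sin t, l * t]"
    and "\<And>t. n t = vector [- cos t, - sin t, 0]"
    and "\<And>t. b t = (1 / \<mu>) *\<^sub>R vector [l * sin t, - (l * cos t), - 1]"
    and "\<And>t. V t = sinh (a * t) *\<^sub>R n t + cosh (a * t) *\<^sub>R b t"
    and "\<And>u v. X u v = vector
      [cosh v * ((a\<^sup>2 + 1) * cos u - (\<mu> - a * l) * sin u * sinh (a * u) * sin (a * v)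
          - (a * \<mu> + l) * cos u * cosh (a * u) * sin (a * v)) / (a\<^sup>2 + 1)
        + sinh v * cos (a * v) * ((a * \<mu> + l) * sin u * sinh (a * u)
          - (\<mu> - a * l) * cos u * cosh (a * u)) / (a\<^sup>2 + 1),
       cosh v * ((a\<^sup>2 + 1) * sin u - (a * \<mu> + l) * sin u * cosh (a * u) * sin (a * v)
          + (\<mu> - a * l) * cos u * sinh (a * u) * sin (a * v)) / (a\<^sup>2 + 1)
        - sinh v * cos (a * v) * ((a * \<mu> + l) * cos u * sinh (a * u)
          + (\<mu> - a * l) * sin u * cosh (a * u)) / (a\<^sup>2 + 1),
       l * u - sinh (a * u) * sin (a * v) / a]"
  shows "bjorling_data UNIV \<alpha> V
    \<and> (\<forall>\<Omega> u\<^sub>0. open \<Omega> \<and> simply_connected \<Omega> \<and> range complex_of_real \<subseteq> \<Omega> \<longrightarrow>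
          bjorling_surface UNIV \<alpha> V \<Omega> u\<^sub>0 X)
    \<and> solves_bjorling_problem UNIV \<alpha> V UNIV X"
proof -
  define m L k :: complex where "m = of_real \<mu>" and "L = of_real l" and "k = of_real a"
  \<comment> \<open>These solve \<open>C + k * D = m\<close> and \<open>k * C - D = - L\<close>, the
    system found by differentiating the form chosen for \<open>P\<close> and matching it with
    \<open>lcross (W z) (cderiv A z)\<close>. Their real counterparts are \<open>c\<close> and
    \<open>d\<close>.\<close>
  define C D where "C = (m - k * L) / (k\<^sup>2 + 1)" and "D = (k * m + L) / (k\<^sup>2 + 1)"
  define c d where "c = (\<mu> - a * l) / (a\<^sup>2 + 1)" and "d = (a * \<mu> + l) / (a\<^sup>2 + 1)"
  define A :: "complex \<Rightarrow> complex ^ 3" where "A z = vector [cos z, sin z, L * z]" for z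
  define W :: "complex \<Rightarrow> complex ^ 3" where "W z = vector
    [- (sinh (k * z) * cos z) + cosh (k * z) * (L * sin z) / m,
     - (sinh (k * z) * sin z) - cosh (k * z) * (L * cos z) / m,
     - (cosh (k * z) / m)]" for z
  define P :: "complex \<Rightarrow> complex ^ 3" where "P z = vector
    [C * sin z * cosh (k * z) + D * cos z * sinh (k * z),
     D * sin z * sinh (k * z) - C * cos z * cosh (k * z),
     cosh (k * z) / k]" for z
  define \<beta> :: "real \<Rightarrow> real ^ 3" where "\<beta> t = vector
    [c * sin t * cosh (a * t) + d * cos t * sinh (a * t),
     d * sin t * sinh (a * t) - c * cos t * cosh (a * t),
     cosh (a * t) / a]" for t
  have l2: "l\<^sup>2 < 1" using assms(2,3) by (simp add: abs_square_less_1)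
  then have mu: "\<mu> > 0" "\<mu>\<^sup>2 = 1 - l\<^sup>2" using assms(4) by simp_all
  have a2: "a\<^sup>2 + 1 \<noteq> 0" by (metis less_numeral_extra(3) sum_power2_gt_zero_iff one_power2 zero_neq_one)
  \<comment> \<open>The zeros of the denominator are \<open>\<i>\<close> and \<open>- \<i>\<close>,
    which the real number \<open>k\<close> avoids.\<close>
  have k2: "k\<^sup>2 + 1 \<noteq> 0"
    using a2 unfolding k_def by (metis of_real_1 of_real_add of_real_eq_0_iff of_real_power)
  have m0: "m \<noteq> 0" and k0: "k \<noteq> 0" and m2: "m\<^sup>2 = 1 - L\<^sup>2"
    using mu assms(1) by (simp_all add: m_def k_def L_def flip: of_real_power)
  have CD: "C + k * D = m" "k * C - D = - L"
  proof -
    have "C * (k\<^sup>2 + 1) = m - k * L" "D * (k\<^sup>2 + 1) = k * m + L"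
      using k2 by (simp_all add: C_def D_def)
    then have "(C + k * D) * (k\<^sup>2 + 1) = m * (k\<^sup>2 + 1)"
      "(k * C - D) * (k\<^sup>2 + 1) = - L * (k\<^sup>2 + 1)"
      by algebra+
    then show "C + k * D = m" "k * C - D = - L"
      using k2 mult_right_cancel by blast+
  qed
  have CD_real: "C = of_real c" "D = of_real d"
    by (simp_all add: C_def D_def c_def d_def m_def L_def k_def)
  have \<alpha>_deriv: "(\<alpha> has_vector_derivative vector [- sin t, cos t, l]) (at t)" for t
  proof (rule has_vector_derivative_vecI)
    fix i show "((\<lambda>t. \<alpha> t $ i) has_real_derivative vector [- sin t, cos t, l] $ i) (at t)"
      using exhaust_3[of i] by (auto simp: assms(5) intro!: derivative_eq_intros)
  qed
  have cderiv_A: "cderiv A z = vector [- sin z, cos z, L]" for z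
  proof (rule cderiv_eqI)
    fix i show "((\<lambda>w. A w $ i) has_field_derivative vector [- sin z, cos z, L] $ i) (at z)"
      using exhaust_3[of i] by (auto simp: A_def intro!: derivative_eq_intros)
  qed
  \<comment> \<open>This is the cross product with its denominators removed: terms with
    \<open>(1 - L\<^sup>2) / m\<close> become terms with \<open>m\<close>, because
    \<open>m\<^sup>2 = 1 - L\<^sup>2\<close>.\<close>
  have cderiv_P: "cderiv P z = vector
      [m * cos z * cosh (k * z) - L * sin z * sinh (k * z),
       L * cos z * sinh (k * z) + m * sin z * cosh (k * z),
       sinh (k * z)]" (is "_ = ?D") for z
  proof (rule cderiv_eqI)
    fix i :: 3
    consider "i = 1" | "i = 2" | "i = 3" using exhaust_3 by blast
    then show "((\<lambda>w. P w $ i) has_field_derivative ?D $ i) (at z)"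
    proof cases
      case 1
      have "((\<lambda>w. C * sin w * cosh (k * w) + D * cos w * sinh (k * w)) has_field_derivative
          (C + k * D) * cos z * cosh (k * z) + (k * C - D) * sin z * sinh (k * z)) (at z)"
        by (auto intro!: derivative_eq_intros simp: algebra_simps)
      with 1 show ?thesis by (simp add: P_def CD)
    next
      case 2
      have "((\<lambda>w. D * sin w * sinh (k * w) - C * cos w * cosh (k * w)) has_field_derivative
          (C + k * D) * sin z * cosh (k * z) - (k * C - D) * cos z * sinh (k * z)) (at z)"
        by (auto intro!: derivative_eq_intros simp: algebra_simps)
      with 2 show ?thesis by (simp add: P_def CD add.commute)
    next
      case 3
      with k0 show ?thesis by (auto simp: P_def intro!: derivative_eq_intros)
    qed
  qed
  have holo: "(\<lambda>z. sinh (k * z)) holomorphic_on S" "(\<lambda>z. cosh (k * z)) holomorphic_on S" for S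
    unfolding sinh_field_def cosh_field_def by (intro holomorphic_intros; simp)+
  have on_reals: "sin (complex_of_real t) = of_real (sin t)" "cos (complex_of_real t) = of_real (cos t)"
    "sinh (k * of_real t) = of_real (sinh (a * t))" "cosh (k * of_real t) = of_real (cosh (a * t))" for t
    by (simp_all add: k_def sin_of_real cos_of_real sinh_of_real cosh_of_real flip: of_real_mult)
  interpret entire_bjorling \<alpha> V \<beta> A W P
  proof
    show "holomorphic_extension UNIV \<alpha> UNIV A"
      unfolding holomorphic_extension_def forall_3
      by (auto simp: A_def assms(5) L_def on_reals intro!: holomorphic_intros)
    show "holomorphic_extension UNIV V UNIV W"
      unfolding holomorphic_extension_def forall_3
      by (auto simp: W_def assms(6-8) L_def m_def on_reals m0[unfolded m_def]
          intro!: holomorphic_intros holo)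
    show "holomorphic_extension UNIV \<beta> UNIV P"
      unfolding holomorphic_extension_def forall_3
      by (auto simp: P_def \<beta>_def CD_real on_reals k0 intro!: holomorphic_intros holo)
         (simp add: k_def)
    fix z
    \<comment> \<open>Naming the inverse of \<open>m\<close> makes the identities below polynomial,
      within reach of \<open>algebra\<close>.\<close>
    define w where "w = 1 / m"
    have mw: "m * w = 1" and div: "x / m = x * w" for x
      using m0 by (simp_all add: w_def)
    have m_eq: "m = w * (1 - L\<^sup>2)"
      using mw m2 by algebra
    have w2: "w\<^sup>2 * (1 - L\<^sup>2) = 1"
      using mw m2 by algebra
    show "cderiv P z = lcross (W z) (cderiv A z)"
      unfolding vec_eq_iff forall_3 cderiv_P cderiv_A
      by (simp add: W_def lcross_def div)
        (intro conjI; use m_eq cos_squared_eq[of z] in algebra)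
    \<comment> \<open>The mixed terms of the first two squares cancel. The grouping isolates
      \<open>(sin z)\<^sup>2 + (cos z)\<^sup>2\<close>, which must survive simplification until the
      two sides have been matched.\<close>
    have "lorentz (W z) (W z) = ((sinh (k * z))\<^sup>2 + (cosh (k * z))\<^sup>2 * w\<^sup>2 * L\<^sup>2) *
        ((sin z)\<^sup>2 + (cos z)\<^sup>2) - (cosh (k * z))\<^sup>2 * w\<^sup>2"
      by (simp add: W_def lorentz_def div del: sin_cos_squared_add) algebra
    also have "\<dots> = (sinh (k * z))\<^sup>2 - (cosh (k * z))\<^sup>2 * (w\<^sup>2 * (1 - L\<^sup>2))"
      by (simp add: algebra_simps)
    also have "\<dots> = -1"
      by (simp add: w2 cosh_square_eq)
    finally show "lorentz (W z) (W z) = -1" .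
    show "lorentz (W z) (cderiv A z) = 0"
      by (simp add: W_def lorentz_def div cderiv_A) (use cos_squared_eq[of z] in algebra)
    fix t
    \<comment> \<open>The square is \<open>1 - l\<^sup>2\<close>; the bound \<open>l < 1\<close>
      enters here through \<open>\<mu> > 0\<close>.\<close>
    have "lorentz (vector_derivative \<alpha> (at t)) (vector_derivative \<alpha> (at t)) = \<mu>\<^sup>2"
      using sin_cos_squared_add[of t]
      by (simp add: vector_derivative_at[OF \<alpha>_deriv] lorentz_def mu(2) flip: power2_eq_square)
    then show "lorentz (vector_derivative \<alpha> (at t)) (vector_derivative \<alpha> (at t)) > 0"
      using mu(1) by simp
  qed
  have "X = surface"
  proof (intro ext)
    fix u v
    have z: "k * Complex u v = Complex (a * u) (a * v)"
      by (simp add: complex_eq_iff k_def)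
    have parts: "sin (Complex u v) = Complex (sin u * cosh v) (cos u * sinh v)"
      "cos (Complex u v) = Complex (cos u * cosh v) (- (sin u * sinh v))"
      "sinh (k * Complex u v) = Complex (sinh (a * u) * cos (a * v)) (cosh (a * u) * sin (a * v))"
      "cosh (k * Complex u v) = Complex (cosh (a * u) * cos (a * v)) (sinh (a * u) * sin (a * v))"
      by (simp_all add: sin_Complex cos_Complex sinh_Complex cosh_Complex z)
    \<comment> \<open>With every factor written by \<open>Complex\<close>, real parts can be read
      off after multiplication.\<close>
    have P: "P (Complex u v) = vector
      [C * Complex (sin u * cosh v) (cos u * sinh v) *
         Complex (cosh (a * u) * cos (a * v)) (sinh (a * u) * sin (a * v)) +
       D * Complex (cos u * cosh v) (- (sin u * sinh v)) *
         Complex (sinh (a * u) * cos (a * v)) (cosh (a * u) * sin (a * v)),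
       D * Complex (sin u * cosh v) (cos u * sinh v) *
         Complex (sinh (a * u) * cos (a * v)) (cosh (a * u) * sin (a * v)) -
       C * Complex (cos u * cosh v) (- (sin u * sinh v)) *
         Complex (cosh (a * u) * cos (a * v)) (sinh (a * u) * sin (a * v)),
       Complex (cosh (a * u) * cos (a * v)) (sinh (a * u) * sin (a * v)) / k]"
      by (simp add: P_def parts)
    \<comment> \<open>Expressing both coefficients as multiples of \<open>a\<^sup>2 + 1\<close>
      cancels the common denominator of the stated formula and leaves the constants \<open>c\<close>
      and \<open>d\<close> of the primitive.\<close>
    have "\<mu> - a * l = c * (a\<^sup>2 + 1)" "a * \<mu> + l = d * (a\<^sup>2 + 1)"
      using a2 by (simp_all add: c_def d_def)
    then have "X u v = vector
      [cosh v * (cos u - c * sin u * sinh (a * u) * sin (a * v)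
          - d * cos u * cosh (a * u) * sin (a * v))
        + sinh v * cos (a * v) * (d * sin u * sinh (a * u) - c * cos u * cosh (a * u)),
       cosh v * (sin u - d * sin u * cosh (a * u) * sin (a * v)
          + c * cos u * sinh (a * u) * sin (a * v))
        - sinh v * cos (a * v) * (d * cos u * sinh (a * u) + c * sin u * cosh (a * u)),
       l * u - sinh (a * u) * sin (a * v) / a]"
      unfolding assms(9) using a2
      by (simp add: vec_eq_iff forall_3 divide_simps) (simp add: algebra_simps)
    then show "X u v = surface u v"
      unfolding vec_eq_iff forall_3
      by (simp add: A_def P sin_Complex cos_Complex CD_real L_def k_def algebra_simps)
  qed
  then show ?thesis
    using bjorling_data bjorling_surface solves_bjorling_problem by simp
qed

end
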